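(* Let $\mathbf{W}$ be a convex body of constant width in $\mathbf{E}^3$. Then $X(\mathbf{W})=3$.
   Context: $\mathbf{E}^3$ is $3$-dimensional Euclidean space. A convex body in $\mathbf{E}^3$ is a compact convex set with non-empty interior. It has constant width if the distance between its two parallel supporting hyperplanes is the same in every direction. X-ray number: for a convex body $\mathbf{K}\subset\mathbf{E}^d$ and a line $L$ through the origin, a point $p\in\mathbf{K}$ is X-rayed along $L$ if the line parallel to $L$ passing through $p$ intersects the interior of $\mathbf{K}$. The X-ray number $X(\mathbf{K})$ is the smallest number of lines through the origin such that every point of $\mathbf{K}$ is X-rayed along at least one of these lines. *)

theory Defs
  imports "HOL-Analysis.Analysis" "HOL-Library.Extended_Nat"
begin

definition convex_body :: "'a::euclidean_space set \<Rightarrow> bool" where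
  "convex_body K \<longleftrightarrow> compact K \<and> convex K \<and> interior K \<noteq> {}"

text \<open>The hyperplane \<open>{x. u \<bullet> x = b}\<close> supports \<open>K\<close>, with outer normal \<open>u\<close>.\<close>

definition supports :: "'a::euclidean_space set \<Rightarrow> 'a \<Rightarrow> real \<Rightarrow> bool" where
  "supports K u b \<longleftrightarrow> K \<subseteq> {x. u \<bullet> x \<le> b} \<and> K \<inter> {x. u \<bullet> x = b} \<noteq> {}"

text \<open>The two supporting hyperplanes orthogonal to \<open>u\<close> are the ones with outer normals
  \<open>u\<close> and \<open>- u\<close>; for compact nonempty \<open>K\<close> both exist and are unique.\<close>

definition constant_width :: "'a::euclidean_space set \<Rightarrow> bool" where
  "constant_width K \<longleftrightarrow>
     (\<exists>w. \<forall>u a b. u \<noteq> 0 \<longrightarrow> supports K u a \<longrightarrow> supports K (- u) b \<longrightarrow>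
        setdist {x. u \<bullet> x = a} {x. (- u) \<bullet> x = b} = w)"

definition line_through_origin :: "'a::euclidean_space set \<Rightarrow> bool" where
  "line_through_origin L \<longleftrightarrow> subspace L \<and> dim L = 1"

definition xrayed_along :: "'a::euclidean_space set \<Rightarrow> 'a \<Rightarrow> 'a set \<Rightarrow> bool" where
  "xrayed_along K p L \<longleftrightarrow> (+) p ` L \<inter> interior K \<noteq> {}"

text \<open>Valued in \<^typ>\<open>enat\<close>, so that the infimum is \<open>\<infinity>\<close> if no finite family of lines
  suffices; otherwise it is attained.\<close>

definition xray_number :: "'a::euclidean_space set \<Rightarrow> enat" where
  "xray_number K = Inf {enat (card \<L>) |\<L>. finite \<L> \<and> (\<forall>L\<in>\<L>. line_through_origin L) \<and>
     (\<forall>p\<in>K. \<exists>L\<in>\<L>. xrayed_along K p L)}"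

end

theory Submission
  imports Defs
begin

text \<open>A point \<open>p\<close> is X-rayed along a line unless some outer normal at \<open>p\<close> is orthogonal to the
  line. Two lines never suffice: a support point in a direction orthogonal to both is missed.

  If \<open>W\<close> has constant width \<open>w\<close> and \<open>u\<close> is a unit normal at \<open>p\<close>, then \<open>p - w u\<close> lies in \<open>W\<close>; as
  \<open>W\<close> has diameter \<open>w\<close>, any two unit normals at \<open>p\<close> form an angle of at most 60 degrees. So if \<open>p\<close>
  is missed by the three axes of an orthonormal frame, the normals orthogonal to the axes must be
  the midpoints of the sides of one of the octants of the unit sphere; call such an octant bad. The
  angle bound, together with the fact that the support points in directions \<open>u\<close> and \<open>- u\<close> differ by \<open>w u\<close>,
  shows that no frame has bad octants of both parities (parity being the sign of the product of the
  three octant signs). If every frame had a bad octant, then, rotating a frame about one axis, the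
  parity would be constant by connectedness; but a quarter turn permutes the octants and reverses
  the parity.\<close>

section \<open>Outer normals and support points\<close>

definition normal_at :: "'a::euclidean_space set \<Rightarrow> 'a \<Rightarrow> 'a \<Rightarrow> bool" where
  "normal_at K p u \<longleftrightarrow> p \<in> K \<and> (\<forall>x\<in>K. u \<bullet> x \<le> u \<bullet> p)"

lemma normal_at_supports: "normal_at K p u \<Longrightarrow> supports K u (u \<bullet> p)"
  by (auto simp: normal_at_def supports_def)

lemma normal_at_scaleR: "normal_at K p u \<Longrightarrow> 0 \<le> c \<Longrightarrow> normal_at K p (c *\<^sub>R u)"
  by (auto simp: normal_at_def mult_left_mono)

lemma normal_at_exists:
  assumes "compact K" "K \<noteq> {}"
  obtains p where "normal_at K p u"
proof -
  have "continuous_on K (\<lambda>x. u \<bullet> x)"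
    by (intro continuous_intros)
  from continuous_attains_sup[OF assms this] show ?thesis
    using that unfolding normal_at_def by blast
qed

text \<open>The interior of a closed halfspace is the open one, so interior points satisfy the
  normal inequality strictly.\<close>

lemma normal_at_interior_less:
  fixes u :: "'a::euclidean_space"
  assumes "normal_at K p u" "u \<noteq> 0" "x \<in> interior K"
  shows "u \<bullet> x < u \<bullet> p"
proof -
  have "interior K \<subseteq> interior {y. u \<bullet> y \<le> u \<bullet> p}"
    using assms(1) by (intro interior_mono) (auto simp: normal_at_def)
  with assms(2,3) show ?thesis by auto
qed

lemma convex_body_nonempty: "convex_body K \<Longrightarrow> K \<noteq> {}"
  unfolding convex_body_def using interior_subset by blast

section \<open>Constant width, diameter and the angle between normals\<close>

text \<open>The common perpendicular from \<open>a *\<^sub>R u\<close> to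
  \<open>- b *\<^sub>R u\<close> realises the distance; Cauchy-Schwarz shows that nothing is
  shorter.\<close>

lemma setdist_opposite_hyperplanes:
  fixes u :: "'a::euclidean_space"
  assumes "norm u = 1"
  shows "setdist {x. u \<bullet> x = a} {x. (- u) \<bullet> x = b} = \<bar>a + b\<bar>"
proof (rule antisym)
  have uu: "u \<bullet> u = 1"
    using assms by (simp add: norm_eq_1)
  have "setdist {x. u \<bullet> x = a} {x. (- u) \<bullet> x = b} \<le> dist (a *\<^sub>R u) (- b *\<^sub>R u)"
    by (rule setdist_le_dist) (simp_all add: uu)
  also have "\<dots> = norm ((a + b) *\<^sub>R u)"
    by (simp add: dist_norm algebra_simps)
  finally show "setdist {x. u \<bullet> x = a} {x. (- u) \<bullet> x = b} \<le> \<bar>a + b\<bar>"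
    using assms by simp
  have "a *\<^sub>R u \<in> {x. u \<bullet> x = a}" "- b *\<^sub>R u \<in> {x. (- u) \<bullet> x = b}"
    by (simp_all add: uu)
  then have ne: "{x. u \<bullet> x = a} \<noteq> {}" "{x. (- u) \<bullet> x = b} \<noteq> {}"
    by blast+
  show "\<bar>a + b\<bar> \<le> setdist {x. u \<bullet> x = a} {x. (- u) \<bullet> x = b}"
  proof (rule le_setdistI[OF ne])
    fix x y assume "x \<in> {x. u \<bullet> x = a}" "y \<in> {x. (- u) \<bullet> x = b}"
    then have "a + b = u \<bullet> (x - y)"
      by (auto simp: inner_diff_right)
    then show "\<bar>a + b\<bar> \<le> dist x y"
      using Cauchy_Schwarz_ineq2[of u "x - y"] assms by (simp add: dist_norm)
  qed
qed

text \<open>A chord is no longer than the width in its own direction, so \<open>w\<close> bounds the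
  diameter. A chord joining opposite support points has component \<open>w\<close> along
  \<open>u\<close> and length at most \<open>w\<close>, which leaves no room for a component
  orthogonal to \<open>u\<close>.\<close>

lemma constant_width_diametral:
  fixes W :: "'a::euclidean_space set"
  assumes "convex_body W" "constant_width W"
  obtains w where "0 < w"
    and "\<And>x y. x \<in> W \<Longrightarrow> y \<in> W \<Longrightarrow> norm (x - y) \<le> w"
    and "\<And>u p q. norm u = 1 \<Longrightarrow> normal_at W p u \<Longrightarrow> normal_at W q (- u) \<Longrightarrow> p - q = w *\<^sub>R u"
proof -
  have cmp: "compact W" and ne: "W \<noteq> {}"
    using assms(1) convex_body_nonempty by (auto simp: convex_body_def)
  obtain w where w: "\<And>u a b. u \<noteq> 0 \<Longrightarrow> supports W u a \<Longrightarrow> supports W (- u) b \<Longrightarrow>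
        setdist {x. u \<bullet> x = a} {x. (- u) \<bullet> x = b} = w"
    using assms(2) unfolding constant_width_def by blast
  have width: "u \<bullet> (p - q) = w"
    if "norm u = 1" "normal_at W p u" "normal_at W q (- u)" for u p q
  proof -
    have "w = \<bar>u \<bullet> p + (- u) \<bullet> q\<bar>"
      using w[of u] that normal_at_supports setdist_opposite_hyperplanes[OF that(1)]
      by (metis norm_zero zero_neq_one)
    moreover have "u \<bullet> q \<le> u \<bullet> p"
      using that by (auto simp: normal_at_def)
    ultimately show ?thesis
      by (simp add: inner_diff_right)
  qed
  \<comment> \<open>Distinct points give the chord a direction; the case \<open>x = y\<close> is
    added at the end, once \<open>0 < w\<close> is known.\<close>
  have diam: "norm (x - y) \<le> w" if "x \<in> W" "y \<in> W" "x \<noteq> y" for x y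
  proof -
    define u where "u = sgn (x - y)"
    obtain p q where pq: "normal_at W p u" "normal_at W q (- u)"
      using normal_at_exists[OF cmp ne] by metis
    have "norm (x - y) = u \<bullet> (x - y)"
      using that(3) by (simp add: u_def sgn_div_norm dot_square_norm power2_eq_square)
    also have "\<dots> \<le> u \<bullet> (p - q)"
      using pq that(1,2) by (auto simp: normal_at_def inner_diff_right intro!: diff_mono)
    also have "\<dots> = w"
      using width pq that(3) by (simp add: u_def norm_sgn)
    finally show ?thesis .
  qed
  obtain v :: 'a where v: "norm v = 1"
    using vector_choose_size[of 1] by auto
  obtain p q where pq: "normal_at W p v" "normal_at W q (- v)"
    using normal_at_exists[OF cmp ne] by metis
  \<comment> \<open>An interior point lies strictly between the two supporting hyperplanes, so the
    width is positive.\<close>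
  obtain z where "z \<in> interior W"
    using assms(1) by (auto simp: convex_body_def)
  then have "v \<bullet> z < v \<bullet> p" "(- v) \<bullet> z < (- v) \<bullet> q"
    using normal_at_interior_less[OF pq(1)] normal_at_interior_less[OF pq(2)] v by fastforce+
  then have pos: "0 < w"
    using width[OF v pq] by (simp add: inner_diff_right)
  have chord: "p - q = w *\<^sub>R u"
    if "norm u = 1" "normal_at W p u" "normal_at W q (- u)" for u p q
  proof -
    have uu: "u \<bullet> u = 1" and wd: "u \<bullet> (p - q) = w"
      using that width by (auto simp: norm_eq_1)
    then have "p \<noteq> q" using pos by auto
    then have "norm (p - q) \<le> w"
      using that diam by (auto simp: normal_at_def)
    then have "(norm (p - q))\<^sup>2 \<le> w\<^sup>2"
      by (simp add: power_mono)
    \<comment> \<open>Pythagoras: \<open>d - w *\<^sub>R u\<close> is the part of \<open>d\<close>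
      orthogonal to \<open>u\<close>.\<close>
    moreover have "(norm (d - w *\<^sub>R u))\<^sup>2 = (norm d)\<^sup>2 - w\<^sup>2" if "u \<bullet> d = w" for d
      unfolding power2_norm_eq_inner
      using uu that by (simp add: inner_diff_left inner_diff_right inner_commute[of d u] power2_eq_square)
    from this[OF wd] have "(norm (p - q - w *\<^sub>R u))\<^sup>2 = (norm (p - q))\<^sup>2 - w\<^sup>2" .
    ultimately have "(norm (p - q - w *\<^sub>R u))\<^sup>2 \<le> 0" by simp
    then show ?thesis by simp
  qed
  show ?thesis
    using that[OF pos _ chord] diam pos by (metis diff_self norm_zero less_imp_le)
qed

text \<open>Both points equal \<open>z + w *\<^sub>R u\<close> for one support point
  \<open>z\<close> in direction \<open>- u\<close>.\<close>

lemma constant_width_normal_unique: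
  fixes W :: "'a::euclidean_space set"
  assumes "convex_body W" "constant_width W" "norm u = 1" "normal_at W p u" "normal_at W q u"
  shows "p = q"
proof -
  obtain z where "normal_at W z (- u)"
    using normal_at_exists assms(1) convex_body_nonempty by (metis convex_body_def)
  then show ?thesis
    using constant_width_diametral[OF assms(1,2)] assms(3-5) by (metis diff_add_cancel)
qed

text \<open>The points of \<open>W\<close> opposite to \<open>p\<close> along \<open>u\<close> and
  \<open>v\<close> are \<open>p - w *\<^sub>R u\<close> and \<open>p - w *\<^sub>R v\<close>. The
  diameter bound gives \<open>norm (u - v) \<le> 1\<close>, that is, an angle of at most 60
  degrees.\<close>

lemma constant_width_normals_inner:
  fixes W :: "'a::euclidean_space set"
  assumes "convex_body W" "constant_width W"
    and u: "norm u = 1" "normal_at W p u" and v: "norm v = 1" "normal_at W p v"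
  shows "1/2 \<le> u \<bullet> v"
proof -
  obtain w where w: "0 < w" "\<And>x y. x \<in> W \<Longrightarrow> y \<in> W \<Longrightarrow> norm (x - y) \<le> w"
    "\<And>u p q. norm u = 1 \<Longrightarrow> normal_at W p u \<Longrightarrow> normal_at W q (- u) \<Longrightarrow> p - q = w *\<^sub>R u"
    using constant_width_diametral[OF assms(1,2)] by blast
  obtain x y where xy: "normal_at W x (- u)" "normal_at W y (- v)"
    using normal_at_exists assms(1) convex_body_nonempty by (metis convex_body_def)
  have "norm (w *\<^sub>R u - w *\<^sub>R v) = norm (y - x)"
    using w(3)[OF u xy(1)] w(3)[OF v xy(2)] by (metis diff_diff_eq2 diff_add_cancel add_diff_cancel_left)
  also have "\<dots> \<le> w"
    using w(2) xy by (auto simp: normal_at_def)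
  finally have "w * norm (u - v) \<le> w"
    using w(1) by (metis abs_of_pos norm_scaleR scaleR_diff_right)
  then have "norm (u - v) \<le> 1"
    using w(1) by simp
  then have "(norm (u - v))\<^sup>2 \<le> 1"
    by (simp add: power_le_one)
  moreover have "(norm (u - v))\<^sup>2 = 2 - 2 * (u \<bullet> v)"
    using u v by (simp add: power2_norm_eq_inner inner_diff_left inner_diff_right inner_commute norm_eq_1)
  ultimately show ?thesis by simp
qed

lemma constant_width_opposite_normals:
  fixes W :: "'a::euclidean_space set"
  assumes "convex_body W" "constant_width W" "norm u = 1" "norm v = 1"
    and "normal_at W p u" "normal_at W p v" "normal_at W q (- u)" "normal_at W q (- v)"
  shows "u = v"
proof -
  obtain w where "0 < w" "p - q = w *\<^sub>R u" "p - q = w *\<^sub>R v"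
    using constant_width_diametral[OF assms(1,2)] assms(3-8) by metis
  then show ?thesis by simp
qed

section \<open>Missed points, and the lower bound for the number of lines\<close>

text \<open>A hyperplane separating the missed line from the interior of \<open>K\<close> has a
  normal orthogonal to the line, and it supports \<open>K\<close> at \<open>p\<close>.\<close>

lemma not_xrayed_normal:
  fixes K :: "'a::euclidean_space set"
  assumes "convex_body K" "p \<in> K" "\<not> xrayed_along K p (span {e})"
  obtains n where "norm n = 1" "normal_at K p n" "n \<bullet> e = 0"
proof -
  let ?L = "(+) p ` span {e}"
  have "convex ?L"
    by (simp add: convex_translation subspace_imp_convex)
  moreover have "?L \<noteq> {}"
    using span_zero by blast
  moreover have "convex (interior K)" "interior K \<noteq> {}"
    using assms(1) by (auto simp: convex_body_def)
  moreover have "interior K \<inter> ?L = {}"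
    using assms(3) by (auto simp: xrayed_along_def)
  ultimately obtain a b where a: "a \<noteq> 0" "\<And>x. x \<in> interior K \<Longrightarrow> a \<bullet> x \<le> b"
      "\<And>x. x \<in> ?L \<Longrightarrow> b \<le> a \<bullet> x"
    by (metis separating_hyperplane_sets)
  have line: "b \<le> a \<bullet> p + t * (a \<bullet> e)" for t
    using a(3)[of "p + t *\<^sub>R e"] by (auto simp: inner_add_right span_singleton)
  \<comment> \<open>A function affine in \<open>t\<close> and bounded below is constant; otherwise
    the chosen \<open>t\<close> would give \<open>b \<le> b - 1\<close>.\<close>
  have ae: "a \<bullet> e = 0"
  proof (rule ccontr)
    assume "a \<bullet> e \<noteq> 0"
    then show False
      using line[of "(b - 1 - a \<bullet> p) / (a \<bullet> e)"] by simp
  qed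
  \<comment> \<open>The separation concerns interior points only; a convex body is contained in the
    closure of its interior, so the bound passes to all of \<open>K\<close>.\<close>
  have "closure (interior K) \<subseteq> {x. a \<bullet> x \<le> b}"
    using a(2) by (intro closure_minimal) (auto simp: closed_halfspace_le)
  moreover have "K \<subseteq> closure (interior K)"
    using assms(1) by (metis convex_closure_interior convex_body_def closure_subset)
  ultimately have "\<forall>x\<in>K. a \<bullet> x \<le> a \<bullet> p"
    using line[of 0] by force
  then have "normal_at K p a"
    using assms(2) by (auto simp: normal_at_def)
  then have "normal_at K p (sgn a)"
    by (simp add: sgn_div_norm normal_at_scaleR)
  then show ?thesis
    using that[of "sgn a"] a(1) ae by (simp add: norm_sgn sgn_div_norm)
qed

text \<open>Fewer than \<open>DIM('a)\<close> lines all lie in some hyperplane with normal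
  \<open>u\<close>. From a support point in direction \<open>u\<close>, moving along any of them
  keeps \<open>u \<bullet> x\<close> maximal and never enters the interior.\<close>

lemma xray_cover_card:
  fixes K :: "'a::euclidean_space set"
  assumes "convex_body K" and fin: "finite \<L>" and lines: "\<And>L. L \<in> \<L> \<Longrightarrow> line_through_origin L"
    and cover: "\<And>p. p \<in> K \<Longrightarrow> \<exists>L\<in>\<L>. xrayed_along K p L"
  shows "DIM('a) \<le> card \<L>"
proof (rule ccontr)
  assume less: "\<not> DIM('a) \<le> card \<L>"
  have "\<exists>l. L = span {l}" if "L \<in> \<L>" for L
  proof -
    have "subspace L" "dim L = 1"
      using lines[OF that] by (auto simp: line_through_origin_def)
    moreover obtain B where "B \<subseteq> L" "independent B" "L \<subseteq> span B" "card B = dim L"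
      by (metis basis_exists)
    ultimately show ?thesis
      by (metis card_1_singletonE span_minimal subset_antisym)
  qed
  then obtain l where l: "\<And>L. L \<in> \<L> \<Longrightarrow> L = span {l L}"
    by metis
  have "dim (l ` \<L>) \<le> card (l ` \<L>)"
    using fin by (intro dim_le_card') simp
  also have "\<dots> \<le> card \<L>"
    using fin by (rule card_image_le)
  finally obtain u where u: "u \<noteq> 0" "span (l ` \<L>) \<subseteq> {x. u \<bullet> x = 0}"
    using lowdim_subset_hyperplane[of "l ` \<L>"] less by auto
  obtain p where p: "normal_at K p u"
    using normal_at_exists assms(1) convex_body_nonempty by (metis convex_body_def)
  then obtain L where L: "L \<in> \<L>" "xrayed_along K p L"
    using cover by (auto simp: normal_at_def)
  then obtain x where x: "x \<in> L" "p + x \<in> interior K"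
    by (auto simp: xrayed_along_def)
  have "L \<subseteq> span (l ` \<L>)"
    using l[OF L(1)] L(1) by (metis empty_subsetI image_eqI insert_subset span_mono)
  with x(1) u(2) have "u \<bullet> x = 0" by auto
  with normal_at_interior_less[OF p u(1) x(2)] show False
    by (simp add: inner_add_right)
qed


section \<open>Closedness of normality conditions, and frames rotating about an axis\<close>

text \<open>The pairs of point and parameter satisfying the inequalities form a closed set;
  projecting away the point, which ranges over the compact \<open>K\<close>, keeps it
  closed.\<close>

lemma closed_normal_at_common:
  fixes f g h :: "real \<Rightarrow> 'a::euclidean_space"
  assumes "compact K" "continuous_on UNIV f" "continuous_on UNIV g" "continuous_on UNIV h"
  shows "closed {\<theta>. \<exists>p. normal_at K p (f \<theta>) \<and> normal_at K p (g \<theta>) \<and> normal_at K p (h \<theta>)}"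
proof -
  have cl: "closed {z. \<forall>x\<in>K. k (snd z) \<bullet> x \<le> k (snd z) \<bullet> fst z}"
    if k: "continuous_on UNIV k" for k :: "real \<Rightarrow> 'a"
  proof -
    have "continuous_on UNIV (\<lambda>z::'a \<times> real. k (snd z))"
      by (intro continuous_on_compose2[OF k] continuous_intros) auto
    then have "closed (\<Inter>x\<in>K. {z. k (snd z) \<bullet> x \<le> k (snd z) \<bullet> fst z})"
      by (intro closed_INT ballI closed_Collect_le continuous_intros)
    moreover have "(\<Inter>x\<in>K. {z. k (snd z) \<bullet> x \<le> k (snd z) \<bullet> fst z}) =
        {z. \<forall>x\<in>K. k (snd z) \<bullet> x \<le> k (snd z) \<bullet> fst z}"
      by auto
    ultimately show ?thesis by simp
  qed
  have "closed ({z. \<forall>x\<in>K. f (snd z) \<bullet> x \<le> f (snd z) \<bullet> fst z} \<inter>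
      {z. \<forall>x\<in>K. g (snd z) \<bullet> x \<le> g (snd z) \<bullet> fst z} \<inter>
      {z. \<forall>x\<in>K. h (snd z) \<bullet> x \<le> h (snd z) \<bullet> fst z})"
    using assms by (intro closed_Int cl)
  from closed_compact_projection[OF assms(1) this] show ?thesis
    by (rule back_subst[of closed]) (auto simp: normal_at_def)
qed

definition frame_x :: "real \<Rightarrow> real ^ 3" where "frame_x \<theta> = vector [cos \<theta>, sin \<theta>, 0]"
definition frame_y :: "real \<Rightarrow> real ^ 3" where "frame_y \<theta> = vector [- sin \<theta>, cos \<theta>, 0]"
definition frame_z :: "real ^ 3" where "frame_z = vector [0, 0, 1]"

lemma frame_inner [simp]:
  "frame_x \<theta> \<bullet> frame_x \<theta> = 1" "frame_y \<theta> \<bullet> frame_y \<theta> = 1" "frame_z \<bullet> frame_z = 1"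
  "frame_x \<theta> \<bullet> frame_y \<theta> = 0" "frame_y \<theta> \<bullet> frame_x \<theta> = 0" "frame_x \<theta> \<bullet> frame_z = 0" "frame_z \<bullet> frame_x \<theta> = 0" "frame_y \<theta> \<bullet> frame_z = 0" "frame_z \<bullet> frame_y \<theta> = 0"
  by (simp_all add: frame_x_def frame_y_def frame_z_def inner_vec_def sum_3 flip: power2_eq_square)

lemma frame_expansion: "v = (v \<bullet> frame_x \<theta>) *\<^sub>R frame_x \<theta> + (v \<bullet> frame_y \<theta>) *\<^sub>R frame_y \<theta> + (v \<bullet> frame_z) *\<^sub>R frame_z"
proof -
  define c s where "c = cos \<theta>" "s = sin \<theta>"
  note cs = this
  have one: "s\<^sup>2 + c\<^sup>2 = 1"
    by (simp add: cs)
  have "(x * c + y * s) * c - (y * c - x * s) * s = x" for x y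
    using one by algebra
  moreover have "(x * c + y * s) * s + (y * c - x * s) * c = y" for x y
    using one by algebra
  ultimately show ?thesis
    by (simp add: frame_x_def frame_y_def frame_z_def inner_vec_def sum_3 vec_eq_iff forall_3 flip: cs)
qed

lemma frame_quarter_turn: "frame_x (pi/2) = frame_y 0" "frame_y (pi/2) = - frame_x 0"
  by (simp_all add: frame_x_def frame_y_def vec_eq_iff forall_3)

lemma continuous_on_frame: "continuous_on S frame_x" "continuous_on S frame_y"
proof -
  have "frame_x = (\<lambda>\<theta>. cos \<theta> *\<^sub>R axis 1 1 + sin \<theta> *\<^sub>R axis 2 1)"
    "frame_y = (\<lambda>\<theta>. (- sin \<theta>) *\<^sub>R axis 1 1 + cos \<theta> *\<^sub>R axis 2 1)"
    by (auto simp: frame_x_def frame_y_def fun_eq_iff vec_eq_iff forall_3 axis_def)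
  note frame = this
  show "continuous_on S frame_x" unfolding frame(1) by (intro continuous_intros)
  show "continuous_on S frame_y" unfolding frame(2) by (intro continuous_intros)
qed

section \<open>Bad octants and the existence of a frame without them\<close>

text \<open>The octant is encoded by the coordinates \<open>s, t, r = \<plusminus>1/\<surd>2\<close> of its side midpoints.\<close>

definition bad_octant :: "(real ^ 3) set \<Rightarrow> real \<Rightarrow> real \<Rightarrow> real \<Rightarrow> real \<Rightarrow> bool" where
  "bad_octant W \<theta> s t r \<longleftrightarrow> (\<exists>p. normal_at W p (t *\<^sub>R frame_y \<theta> + r *\<^sub>R frame_z) \<and>
     normal_at W p (s *\<^sub>R frame_x \<theta> + r *\<^sub>R frame_z) \<and> normal_at W p (s *\<^sub>R frame_x \<theta> + t *\<^sub>R frame_y \<theta>))"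

lemma closed_bad_octant: "compact W \<Longrightarrow> closed {\<theta>. bad_octant W \<theta> s t r}"
  unfolding bad_octant_def
  by (intro closed_normal_at_common) (auto intro!: continuous_intros continuous_on_frame)

text \<open>The frames at \<open>0\<close> and \<open>pi/2\<close> have the same axes up to sign, so
  the octants are only relabelled. The product of the labels changes from \<open>s * t * r\<close>
  to its negative.\<close>

lemma bad_octant_quarter_turn: "bad_octant W (pi/2) s t r \<longleftrightarrow> bad_octant W 0 (- t) s r"
proof -
  have "t *\<^sub>R (- frame_x 0) = (- t) *\<^sub>R frame_x 0" "s *\<^sub>R frame_y 0 + (- t) *\<^sub>R frame_x 0 = (- t) *\<^sub>R frame_x 0 + s *\<^sub>R frame_y 0"
    by simp_all
  then show ?thesis
    unfolding bad_octant_def frame_quarter_turn by metis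
qed

text \<open>Each missed axis supplies a unit normal at \<open>p\<close> orthogonal to it. Two such
  normals share a single coordinate direction, so the angle bound becomes a lower bound on one
  product of coordinates.\<close>

lemma bad_octant_if_not_xrayed:
  assumes "convex_body W" "constant_width W" "p \<in> W"
    and "\<not> xrayed_along W p (span {frame_x \<theta>})" "\<not> xrayed_along W p (span {frame_y \<theta>})"
      "\<not> xrayed_along W p (span {frame_z})"
  obtains s t r where "s\<^sup>2 = 1/2" "t\<^sup>2 = 1/2" "r\<^sup>2 = 1/2" "bad_octant W \<theta> s t r"
proof -
  obtain a where a: "norm a = 1" "normal_at W p a" "a \<bullet> frame_x \<theta> = 0"
    using not_xrayed_normal assms by metis
  obtain b where b: "norm b = 1" "normal_at W p b" "b \<bullet> frame_y \<theta> = 0"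
    using not_xrayed_normal assms by metis
  obtain c where c: "norm c = 1" "normal_at W p c" "c \<bullet> frame_z = 0"
    using not_xrayed_normal assms by metis
  define a2 a3 b1 b3 c1 c2 where defs: "a2 = a \<bullet> frame_y \<theta>" "a3 = a \<bullet> frame_z" "b1 = b \<bullet> frame_x \<theta>" "b3 = b \<bullet> frame_z"
    "c1 = c \<bullet> frame_x \<theta>" "c2 = c \<bullet> frame_y \<theta>"
  have exp: "a = a2 *\<^sub>R frame_y \<theta> + a3 *\<^sub>R frame_z" "b = b1 *\<^sub>R frame_x \<theta> + b3 *\<^sub>R frame_z"
    "c = c1 *\<^sub>R frame_x \<theta> + c2 *\<^sub>R frame_y \<theta>"
    using frame_expansion[of a \<theta>] frame_expansion[of b \<theta>] frame_expansion[of c \<theta>] a b c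
    by (simp_all add: defs)
  have "a \<bullet> a = 1" "b \<bullet> b = 1" "c \<bullet> c = 1"
    using a b c by (simp_all add: norm_eq_1)
  then have unit: "a2\<^sup>2 + a3\<^sup>2 = 1" "b1\<^sup>2 + b3\<^sup>2 = 1" "c1\<^sup>2 + c2\<^sup>2 = 1"
    unfolding exp by (simp_all add: inner_add_left inner_add_right power2_eq_square)
  have "1/2 \<le> a \<bullet> b" "1/2 \<le> a \<bullet> c" "1/2 \<le> b \<bullet> c"
    using constant_width_normals_inner[OF assms(1,2)] a b c by blast+
  then have prods: "1/2 \<le> a3 * b3" "1/2 \<le> a2 * c2" "1/2 \<le> b1 * c1"
    unfolding exp by (simp_all add: inner_add_left inner_add_right mult.commute)
  text \<open>AM-GM turns the three lower bounds into \<open>1\<close> each, while the six squares sum to \<open>3\<close>;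
    hence equality holds everywhere.\<close>
  have "0 \<le> (a3 - b3)\<^sup>2" "0 \<le> (a2 - c2)\<^sup>2" "0 \<le> (b1 - c1)\<^sup>2" by simp_all
  then have sq: "(a3 - b3)\<^sup>2 = 0" "(a2 - c2)\<^sup>2 = 0" "(b1 - c1)\<^sup>2 = 0"
    using unit prods unfolding power2_diff by argo+
  then have eqs: "b3 = a3" "c2 = a2" "c1 = b1" by simp_all
  then have "b1\<^sup>2 = 1/2" "a2\<^sup>2 = 1/2" "a3\<^sup>2 = 1/2"
    using unit by simp_all
  moreover have "bad_octant W \<theta> b1 a2 a3"
    using a(2) b(2) c(2) unfolding bad_octant_def exp eqs by blast
  ultimately show ?thesis using that by blast
qed

text \<open>Octants of opposite parity differ in one sign or in all three. If one sign differs, the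
  side midpoint not involving it is a normal at both points, so the points agree; but two normals
  differing in that sign are orthogonal. If all differ, the normals at \<open>q\<close> are opposite
  to those at \<open>p\<close>, which forces distinct midpoints to coincide.\<close>

lemma bad_octant_parity:
  assumes W: "convex_body W" "constant_width W"
    and sq: "s\<^sup>2 = 1/2" "t\<^sup>2 = 1/2" "r\<^sup>2 = 1/2" "s'\<^sup>2 = 1/2" "t'\<^sup>2 = 1/2" "r'\<^sup>2 = 1/2"
    and bad: "bad_octant W \<theta> s t r" "bad_octant W \<theta> s' t' r'"
  shows "s' * t' * r' = s * t * r"
proof -
  define a b c where "a = (\<lambda>t r. t *\<^sub>R frame_y \<theta> + r *\<^sub>R frame_z)" "b = (\<lambda>s r. s *\<^sub>R frame_x \<theta> + r *\<^sub>R frame_z)"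
    "c = (\<lambda>s t. s *\<^sub>R frame_x \<theta> + t *\<^sub>R frame_y \<theta>)"
  note abc = this
  obtain p where p: "normal_at W p (a t r)" "normal_at W p (b s r)" "normal_at W p (c s t)"
    using bad(1) unfolding bad_octant_def abc by blast
  obtain q where q: "normal_at W q (a t' r')" "normal_at W q (b s' r')" "normal_at W q (c s' t')"
    using bad(2) unfolding bad_octant_def abc by blast
  have unit: "norm (a x y) = 1" "norm (b x y) = 1" "norm (c x y) = 1" if "x\<^sup>2 = 1/2" "y\<^sup>2 = 1/2" for x y
    using that by (simp_all add: abc norm_eq_1 inner_add_left inner_add_right power2_eq_square)
  have not_flip_s: "\<not> (s' = - s \<and> t' = t \<and> r' = r)"
  proof
    assume h: "s' = - s \<and> t' = t \<and> r' = r"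
    then have "q = p"
      using constant_width_normal_unique[OF W _ _ p(1)] q(1) sq unit by auto
    then have "1/2 \<le> b s r \<bullet> b (- s) r"
      using p q h sq unit by (intro constant_width_normals_inner[OF W]) auto
    then show False
      using sq by (simp add: abc inner_add_left inner_add_right inner_diff_right power2_eq_square)
  qed
  have not_flip_t: "\<not> (s' = s \<and> t' = - t \<and> r' = r)"
  proof
    assume h: "s' = s \<and> t' = - t \<and> r' = r"
    then have "q = p"
      using constant_width_normal_unique[OF W _ _ p(2)] q(2) sq unit by auto
    then have "1/2 \<le> a t r \<bullet> a (- t) r"
      using p q h sq unit by (intro constant_width_normals_inner[OF W]) auto
    then show False
      using sq by (simp add: abc inner_add_left inner_add_right inner_diff_right power2_eq_square)
  qed
  have not_flip_r: "\<not> (s' = s \<and> t' = t \<and> r' = - r)"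
  proof
    assume h: "s' = s \<and> t' = t \<and> r' = - r"
    then have "q = p"
      using constant_width_normal_unique[OF W _ _ p(3)] q(3) sq unit by auto
    then have "1/2 \<le> a t r \<bullet> a t (- r)"
      using p q h sq unit by (intro constant_width_normals_inner[OF W]) auto
    then show False
      using sq by (simp add: abc inner_add_left inner_add_right inner_diff_right power2_eq_square)
  qed
  have not_antipodal: "\<not> (s' = - s \<and> t' = - t \<and> r' = - r)"
  proof
    assume h: "s' = - s \<and> t' = - t \<and> r' = - r"
    then have "a t' r' = - a t r" "b s' r' = - b s r"
      by (simp_all add: abc)
    then have "a t r = b s r"
      using p q sq unit by (intro constant_width_opposite_normals[OF W]) auto
    \<comment> \<open>Comparing first coordinates gives \<open>0 = s\<close>, against
      \<open>s\<^sup>2 = 1/2\<close>.\<close>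
    then have "a t r \<bullet> frame_x \<theta> = b s r \<bullet> frame_x \<theta>" by simp
    then show False
      using sq by (simp add: abc inner_add_left)
  qed
  have "s' = s \<or> s' = - s" "t' = t \<or> t' = - t" "r' = r \<or> r' = - r"
    using sq by (simp_all flip: power2_eq_iff)
  then show ?thesis
    using not_flip_s not_flip_t not_flip_r not_antipodal by (elim disjE) simp_all
qed

lemma exists_good_frame:
  assumes "convex_body W" "constant_width W"
  obtains \<theta> where "\<And>s t r. s\<^sup>2 = 1/2 \<Longrightarrow> t\<^sup>2 = 1/2 \<Longrightarrow> r\<^sup>2 = 1/2 \<Longrightarrow> \<not> bad_octant W \<theta> s t r"
proof (rule ccontr)
  note W = assms
  assume "\<not> thesis"
  then have all_frames_bad: "\<exists>s t r. s\<^sup>2 = 1/2 \<and> t\<^sup>2 = 1/2 \<and> r\<^sup>2 = 1/2 \<and> bad_octant W \<theta> s t r" for \<theta>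
    using that by blast
  \<comment> \<open>\<open>P\<close> stands for a sign condition on the product, so that both
    parities are treated at once. \<open>B P\<close> collects the angles with a bad octant of that
    parity, a finite union of closed sets.\<close>
  define S where "S P = {(s, t, r). s\<^sup>2 = (1/2::real) \<and> t\<^sup>2 = (1/2::real) \<and> r\<^sup>2 = (1/2::real) \<and> P (s * t * r)}" for P
  define B where "B P = (\<Union>(s, t, r)\<in>S P. {\<theta>. bad_octant W \<theta> s t r})" for P :: "real \<Rightarrow> bool"
  have B_iff: "\<theta> \<in> B P \<longleftrightarrow> (\<exists>s t r. s\<^sup>2 = 1/2 \<and> t\<^sup>2 = 1/2 \<and> r\<^sup>2 = 1/2 \<and> P (s * t * r) \<and> bad_octant W \<theta> s t r)" for \<theta> P
    by (auto simp: B_def S_def)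
  have "finite (S P)" for P
  proof (rule finite_subset)
    let ?R = "{sqrt (1/2), - sqrt (1/2)}"
    have "x \<in> ?R" if "x\<^sup>2 = 1/2" for x :: real
    proof -
      have "x\<^sup>2 = (sqrt (1/2))\<^sup>2" using that by simp
      then show ?thesis by (simp only: power2_eq_iff) auto
    qed
    then show "S P \<subseteq> ?R \<times> ?R \<times> ?R"
      unfolding S_def by blast
  qed simp
  then have closed: "closed (B P)" for P
    using W(1) unfolding B_def
    by (intro closed_UN) (auto simp: convex_body_def intro: closed_bad_octant)
  have swap: "0 \<in> B (\<lambda>x. P (- x))" if turn: "pi/2 \<in> B P" for P
  proof -
    obtain s t r where "s\<^sup>2 = 1/2" "t\<^sup>2 = 1/2" "r\<^sup>2 = 1/2" "P (s * t * r)" "bad_octant W 0 (- t) s r"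
      using turn unfolding B_iff bad_octant_quarter_turn by blast
    then show ?thesis
      unfolding B_iff by (intro exI[of _ "- t"] exI[of _ s] exI[of _ r]) (simp add: mult_ac)
  qed
  have cover: "\<theta> \<in> B (\<lambda>x. 0 < x) \<or> \<theta> \<in> B (\<lambda>x. x < 0)" for \<theta>
  proof -
    obtain s t r where *: "s\<^sup>2 = 1/2" "t\<^sup>2 = 1/2" "r\<^sup>2 = 1/2" "bad_octant W \<theta> s t r"
      using all_frames_bad by blast
    then have "s * t * r \<noteq> 0" by auto
    with * show ?thesis
      unfolding B_iff by (meson linorder_neqE_linordered_idom)
  qed
  have disjoint: "\<not> (\<theta> \<in> B (\<lambda>x. 0 < x) \<and> \<theta> \<in> B (\<lambda>x. x < 0))" for \<theta>
  proof
    assume "\<theta> \<in> B (\<lambda>x. 0 < x) \<and> \<theta> \<in> B (\<lambda>x. x < 0)"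
    then obtain s t r s' t' r' where "s\<^sup>2 = 1/2" "t\<^sup>2 = 1/2" "r\<^sup>2 = 1/2" "0 < s * t * r" "bad_octant W \<theta> s t r"
      "s'\<^sup>2 = 1/2" "t'\<^sup>2 = 1/2" "r'\<^sup>2 = 1/2" "s' * t' * r' < 0" "bad_octant W \<theta> s' t' r'"
      unfolding B_iff by blast
    with bad_octant_parity[OF W, of s t r s' t' r' \<theta>] show False by simp
  qed
  \<comment> \<open>Whichever parity occurs at \<open>pi/2\<close>, the opposite one occurs at
    \<open>0\<close>. Hence both closed sets are nonempty, and they would disconnect the real
    line.\<close>
  have "0 \<in> B (\<lambda>x. 0 < x) \<and> pi/2 \<in> B (\<lambda>x. x < 0) \<or> 0 \<in> B (\<lambda>x. x < 0) \<and> pi/2 \<in> B (\<lambda>x. 0 < x)"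
    using cover[of "pi/2"] swap[of "\<lambda>x. 0 < x"] swap[of "\<lambda>x. x < 0"] by auto
  then have "B (\<lambda>x. 0 < x) \<noteq> {}" "B (\<lambda>x. x < 0) \<noteq> {}"
    by auto
  moreover have "B (\<lambda>x. 0 < x) \<union> B (\<lambda>x. x < 0) = UNIV" "B (\<lambda>x. 0 < x) \<inter> B (\<lambda>x. x < 0) = {}"
    using cover disjoint by auto
  ultimately have "\<not> connected (UNIV :: real set)"
    unfolding connected_closed_set[OF closed_UNIV] using closed by metis
  then show False by simp
qed

section \<open>The X-ray number\<close>

lemma line_through_origin_span: "e \<noteq> 0 \<Longrightarrow> line_through_origin (span {e})"
  by (simp add: line_through_origin_def dim_eq_card_independent)

theorem mainTheorem4:
  fixes W :: "(real ^ 3) set"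
  assumes "convex_body W" and "constant_width W"
  shows "xray_number W = 3"
proof (rule antisym)
  obtain \<theta> where good: "\<And>s t r. s\<^sup>2 = 1/2 \<Longrightarrow> t\<^sup>2 = 1/2 \<Longrightarrow> r\<^sup>2 = 1/2 \<Longrightarrow> \<not> bad_octant W \<theta> s t r"
    using exists_good_frame[OF assms] by blast
  define \<L> where "\<L> = {span {frame_x \<theta>}, span {frame_y \<theta>}, span {frame_z}}"
  have "frame_x \<theta> \<noteq> 0" "frame_y \<theta> \<noteq> 0" "frame_z \<noteq> 0"
    by (metis frame_inner(1-3) inner_zero_left zero_neq_one)+
  then have "\<forall>L\<in>\<L>. line_through_origin L"
    by (auto simp: \<L>_def line_through_origin_span)
  \<comment> \<open>A point missed by all three axes would produce a bad octant of the good
    frame.\<close>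
  moreover have "\<forall>p\<in>W. \<exists>L\<in>\<L>. xrayed_along W p L"
    using bad_octant_if_not_xrayed[OF assms] good unfolding \<L>_def by (metis insertI1 insertI2)
  moreover have "finite \<L>" by (simp add: \<L>_def)
  ultimately have "xray_number W \<le> enat (card \<L>)"
    unfolding xray_number_def by (intro Inf_lower) blast
  also have "card \<L> \<le> 3"
    unfolding \<L>_def by (simp add: card_insert_if)
  then have "enat (card \<L>) \<le> 3"
    by (simp add: numeral_eq_enat)
  finally show "xray_number W \<le> 3" .
  have "3 \<le> card \<L>" if "finite \<L>" "\<forall>L\<in>\<L>. line_through_origin L" "\<forall>p\<in>W. \<exists>L\<in>\<L>. xrayed_along W p L"
    for \<L> :: "(real ^ 3) set set"
    using xray_cover_card[OF assms(1) that(1)] that by simp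
  then show "3 \<le> xray_number W"
    unfolding xray_number_def by (intro Inf_greatest) (auto simp: numeral_eq_enat)
qed

end
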